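(* (i) If $f$ is a balanced domination function (BDF) on a full binary tree $T$ with root vertex $r$, then $f(r)=0$. (ii) Every full binary tree is $d$-balanced.
   Context: For a simple undirected finite graph $G$ and $v\in V(G)$, the closed neighborhood is $N_G[v]=\{u\in V(G): uv\in E(G)\}\cup\{v\}$. A function $f\colon V(G)\to\{-1,0,1\}$ is a balanced domination function (BDF) on $G$ if $\sum_{u\in N_G[v]} f(u)=0$ for every $v\in V(G)$. Its weight is $\omega_f=\sum_{v\in V(G)} f(v)$. The balanced domination number $\gamma_{bd}(G)$ is the maximum of $\omega_f$ over all BDFs $f$ on $G$. The graph $G$ is called $d$-balanced if $\gamma_{bd}(G)=0$. A (finite) rooted tree is a binary tree if every vertex has at most two children. A binary tree is a full binary tree if each of its vertices has exactly $0$ or $2$ children. *)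

theory Defs
  imports "Graph_Theory.Graph_Theory"
begin

text \<open>
  Finite simple undirected graphs are represented by the locale \<^locale>\<open>graph\<close>: finite, symmetric,
  loop-free digraphs without parallel arcs.
\<close>

definition closed_nbhd :: "('a,'b) pre_digraph \<Rightarrow> 'a \<Rightarrow> 'a set" where
  "closed_nbhd G v = {u \<in> verts G. u \<rightarrow>\<^bsub>G\<^esub> v} \<union> {v}"

text \<open>Only the values on the vertex set matter; \<open>f\<close> is unconstrained elsewhere.\<close>

definition bdf :: "('a,'b) pre_digraph \<Rightarrow> ('a \<Rightarrow> int) \<Rightarrow> bool" where
  "bdf G f \<longleftrightarrow>
     (\<forall>v \<in> verts G. f v \<in> {-1, 0, 1}) \<and>
     (\<forall>v \<in> verts G. (\<Sum>u \<in> closed_nbhd G v. f u) = 0)"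

definition weight :: "('a,'b) pre_digraph \<Rightarrow> ('a \<Rightarrow> int) \<Rightarrow> int" where
  "weight G f = (\<Sum>v \<in> verts G. f v)"

text \<open>
  For a finite graph the weights form a finite set (they have absolute value at most the number of
  vertices), nonempty because of the zero function, so this is a genuine maximum.
\<close>

definition balanced_dom_number :: "('a,'b) pre_digraph \<Rightarrow> int" where
  "balanced_dom_number G = Max {weight G f | f. bdf G f}"

definition d_balanced :: "('a,'b) pre_digraph \<Rightarrow> bool" where
  "d_balanced G \<longleftrightarrow> balanced_dom_number G = 0"

text \<open>
  The library predicate \<^const>\<open>tree\<close> is about digraphs and counts \<open>u, v, u\<close> as a cycle, so no symmetric
  digraph with an arc satisfies it. Requiring length at least 3 gives the cycles of the underlying
  undirected simple graph. The predicate \<^const>\<open>Digraph_Component.connected\<close> includes nonemptiness.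
\<close>

definition undirected_tree :: "('a,'b) pre_digraph \<Rightarrow> bool" where
  "undirected_tree G \<longleftrightarrow>
     graph G \<and> Digraph_Component.connected G \<and>
     \<not> (\<exists>p. pre_digraph.cycle G p \<and> length p \<ge> 3)"

definition rooted_tree :: "('a,'b) pre_digraph \<Rightarrow> 'a \<Rightarrow> bool" where
  "rooted_tree T r \<longleftrightarrow> undirected_tree T \<and> r \<in> verts T"

text \<open>The children of \<open>v\<close> are the neighbors \<open>u\<close> of \<open>v\<close> such that the path from the root to \<open>u\<close>
  passes through \<open>v\<close>.\<close>

definition children :: "('a,'b) pre_digraph \<Rightarrow> 'a \<Rightarrow> 'a \<Rightarrow> 'a set" where
  "children T r v =
     {u \<in> verts T. v \<rightarrow>\<^bsub>T\<^esub> u \<and>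
        (\<exists>p. pre_digraph.apath T r p u \<and> v \<in> set (pre_digraph.awalk_verts T r p))}"

definition binary_tree :: "('a,'b) pre_digraph \<Rightarrow> 'a \<Rightarrow> bool" where
  "binary_tree T r \<longleftrightarrow> rooted_tree T r \<and> (\<forall>v \<in> verts T. card (children T r v) \<le> 2)"

definition full_binary_tree :: "('a,'b) pre_digraph \<Rightarrow> 'a \<Rightarrow> bool" where
  "full_binary_tree T r \<longleftrightarrow>
     binary_tree T r \<and> (\<forall>v \<in> verts T. card (children T r v) \<in> {0, 2})"

end

theory Submission
  imports Defs
begin

text \<open>
  For every non-root vertex \<open>v\<close> with parent \<open>u\<close>, \<open>f u\<close> and \<open>f v\<close> have the same parity: by induction
  from the leaves upwards, the (zero or two) children of \<open>v\<close> have the parity of \<open>f v\<close>, so they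
  contribute an even amount to the sum over the closed neighborhood of \<open>v\<close>, leaving \<open>f u + f v\<close> even.
  At the root there is no parent, so \<open>f r\<close> is even. By connectedness \<open>f\<close> is even everywhere, and as its
  values lie in \<open>{-1, 0, 1}\<close> it vanishes. Hence zero is the only BDF, up to irrelevant values outside
  the graph.
\<close>

section \<open>Walks, paths and vertex deletion\<close>

text \<open>Links two views of avoiding \<open>v\<close>: reachability composes easily, while the
  path form is the one that can be compared with \<open>children\<close>.\<close>

lemma (in wf_digraph) reachable_del_vert_iff_apath:
  "u \<rightarrow>\<^sup>*\<^bsub>del_vert v\<^esub> w \<longleftrightarrow> (\<exists>p. apath u p w \<and> v \<notin> set (awalk_verts u p))"
proof
  interpret D: wf_digraph "del_vert v" by (rule wf_digraph_del_vert)
  assume "u \<rightarrow>\<^sup>*\<^bsub>del_vert v\<^esub> w"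
  then obtain p where p: "D.apath u p w" by (auto simp: D.reachable_apath)
  have "apath u p w" by (rule subgraph_apath_imp_apath[OF p subgraph_del_vert])
  moreover have "set (D.awalk_verts u p) \<subseteq> verts (del_vert v)"
    using p unfolding D.apath_def D.awalk_conv by blast
  \<comment> \<open>Deletion leaves the maps \<open>tail\<close> and \<open>head\<close> unchanged,
    so an arc list visits the same vertices in both digraphs.\<close>
  moreover have "D.awalk_verts u p = awalk_verts u p"
    by (induction p arbitrary: u) (auto simp: D.awalk_verts.simps del_vert_simps)
  ultimately show "\<exists>p. apath u p w \<and> v \<notin> set (awalk_verts u p)"
    by (auto simp: del_vert_simps)
next
  interpret D: wf_digraph "del_vert v" by (rule wf_digraph_del_vert)
  assume "\<exists>p. apath u p w \<and> v \<notin> set (awalk_verts u p)"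
  then obtain p where "awalk u p w" "v \<notin> set (awalk_verts u p)" by (auto simp: apath_def)
  then have "D.awalk u p w"
  proof (induction p arbitrary: u)
    case Nil
    then show ?case by (auto simp: awalk_Nil_iff D.awalk_Nil_iff del_vert_simps)
  next
    case (Cons a p)
    \<comment> \<open>The head of \<open>a\<close> starts the remaining walk and so differs from
      \<open>v\<close>; hence \<open>a\<close> survives the deletion.\<close>
    moreover have "head G a \<in> set (awalk_verts (head G a) p)" 
      using Cons.prems(1) by (intro hd_in_awalk_verts(1)) (auto simp: awalk_Cons_iff)
    ultimately show ?case
      by (auto simp: awalk_Cons_iff D.awalk_Cons_iff del_vert_simps)
  qed
  then show "u \<rightarrow>\<^sup>*\<^bsub>del_vert v\<^esub> w" by (rule D.reachable_awalkI)
qed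

lemma (in wf_digraph) last_in_awalk_verts:
  assumes "awalk u p v"
  shows "v \<in> set (awalk_verts u p)"
  using last_in_set[of "awalk_verts u p"] assms by simp

lemma (in wf_digraph) awalk_verts_snoc:
  assumes "awalk u (p @ [a]) v"
  shows "awalk_verts u (p @ [a]) = awalk_verts u p @ [v]"
  using assms awalk_verts_append[OF assms] by (auto simp: awalk_simps)

lemma (in wf_digraph) apath_snocE:
  assumes "apath u p v" "v \<rightarrow>\<^bsub>G\<^esub> w" "w \<notin> set (awalk_verts u p)"
  obtains q where "apath u q w" "set (awalk_verts u q) = insert w (set (awalk_verts u p))"
proof -
  obtain a where a: "a \<in> arcs G" "tail G a = v" "head G a = w"
    using assms(2) by (auto simp: arcs_ends_def arc_to_ends_def)
  have p: "awalk u p v" "distinct (awalk_verts u p)" using assms(1) by (auto simp: apath_def)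
  then have aw: "awalk u (p @ [a]) w" using a by (auto simp: awalk_simps)
  then have "awalk_verts u (p @ [a]) = awalk_verts u p @ [w]" by (rule awalk_verts_snoc)
  then show thesis using aw p assms(3) by (intro that[of "p @ [a]"]) (auto simp: apath_def)
qed

section \<open>The parent relation of a rooted tree\<close>

locale rooted_undirected_tree = graph G for G :: "('a, 'b) pre_digraph" (structure) +
  fixes r :: 'a
  assumes connected: "Digraph_Component.connected G"
    and acyclic: "cycle p \<Longrightarrow> length p < 3"
    and root_in_verts: "r \<in> verts G"
begin

text \<open>Reachability avoiding \<open>v\<close> says that \<open>u\<close> stays on the root's
  side when \<open>v\<close> is deleted. This form makes uniqueness of parents a matter of symmetry
  and transitivity.\<close>

definition parent :: "'a \<Rightarrow> 'a \<Rightarrow> bool" where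
  "parent u v \<longleftrightarrow> u \<rightarrow>\<^bsub>G\<^esub> v \<and> r \<rightarrow>\<^sup>*\<^bsub>del_vert v\<^esub> u"

lemma adj_sym: "u \<rightarrow>\<^bsub>G\<^esub> v \<Longrightarrow> v \<rightarrow>\<^bsub>G\<^esub> u"
  using sym_arcs by (auto simp: symmetric_def sym_def)

lemma apath_from_root:
  assumes "v \<in> verts G"
  obtains p where "apath r p v"
proof -
  have "r \<rightarrow>\<^sup>*\<^bsub>G\<^esub> v"
    using symmetric_connected_imp_strongly_connected[OF sym_arcs connected] root_in_verts assms
    unfolding strongly_connected_def by blast
  then show thesis using that unfolding reachable_apath by blast
qed

lemma parent_iff_apath:
  "parent u v \<longleftrightarrow> u \<rightarrow>\<^bsub>G\<^esub> v \<and> (\<exists>p. apath r p u \<and> v \<notin> set (awalk_verts r p))"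
  unfolding parent_def reachable_del_vert_iff_apath ..

lemma not_parent_root: "\<not> parent u r"
  unfolding parent_iff_apath apath_def using hd_in_awalk_verts(1) by blast

lemma apath_snoc_parent:
  assumes "apath r (p @ [a]) v"
  shows "parent (tail G a) v" "tail G a \<in> set (awalk_verts r p)"
proof -
  have aw: "awalk r (p @ [a]) v" and d: "distinct (awalk_verts r (p @ [a]))"
    using assms by (auto simp: apath_def)
  from aw have a: "a \<in> arcs G" "head G a = v" and p: "awalk r p (tail G a)"
    by (auto simp: awalk_simps)
  from d have "distinct (awalk_verts r p)" "v \<notin> set (awalk_verts r p)"
    by (auto simp: awalk_verts_snoc[OF aw])
  moreover have "tail G a \<rightarrow>\<^bsub>G\<^esub> v" using a by (metis in_arcs_imp_in_arcs_ends)
  ultimately show "parent (tail G a) v" using p by (auto simp: parent_iff_apath apath_def)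
  show "tail G a \<in> set (awalk_verts r p)"
    using p by (rule last_in_awalk_verts)
qed

text \<open>Two distinct parents of \<open>v\<close> are both connected to the root after deleting
  \<open>v\<close>, hence to each other by a path avoiding \<open>v\<close>. Closing this path up
  through \<open>v\<close> gives a forbidden cycle.\<close>

lemma parent_unique:
  assumes "parent u v" "parent w v"
  shows "u = w"
proof (rule ccontr)
  assume "u \<noteq> w"
  interpret D: wf_digraph "del_vert v" by (rule wf_digraph_del_vert)
  have "x \<rightarrow>\<^bsub>del_vert v\<^esub> y \<longleftrightarrow> x \<rightarrow>\<^bsub>G\<^esub> y \<and> x \<noteq> v \<and> y \<noteq> v" for x y
    by (auto simp: arcs_ends_def arc_to_ends_def del_vert_simps)
  then have "symmetric (del_vert v)"
    using adj_sym by (auto simp: symmetric_def intro!: symI)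
  then have "u \<rightarrow>\<^sup>*\<^bsub>del_vert v\<^esub> r"
    using assms(1) by (auto simp: parent_def intro: symmetric_reachable)
  then have "u \<rightarrow>\<^sup>*\<^bsub>del_vert v\<^esub> w"
    using assms(2) D.reachable_trans unfolding parent_def by blast
  then obtain p where p: "awalk u p w" "distinct (awalk_verts u p)" "v \<notin> set (awalk_verts u p)"
    by (auto simp: reachable_del_vert_iff_apath apath_def)
  obtain a where a: "a \<in> arcs G" "tail G a = v" "head G a = u"
    using adj_sym[of u v] assms(1) by (auto simp: parent_def arcs_ends_def arc_to_ends_def)
  obtain b where b: "b \<in> arcs G" "tail G b = w" "head G b = v"
    using assms(2) by (auto simp: parent_def arcs_ends_def arc_to_ends_def)
  have pb: "awalk u (p @ [b]) v" using p(1) b by (auto simp: awalk_simps)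
  have "cycle (a # p @ [b])"
    unfolding cycle_def
    using pb a p by (intro exI[of _ v]) (auto simp: awalk_Cons_iff awalk_verts_snoc[OF pb])
  \<comment> \<open>The cycle has two arcs more than \<open>p\<close>, so a length below 3 leaves no
    arc for \<open>p\<close>.\<close>
  then have "p = []" using acyclic by (cases p) force+
  then show False using p(1) \<open>u \<noteq> w\<close> by (simp add: awalk_Nil_iff)
qed

lemma parent_exists:
  assumes "v \<in> verts G" "v \<noteq> r"
  shows "\<exists>u. parent u v"
proof -
  obtain p where p: "apath r p v" using apath_from_root[OF assms(1)] .
  then have "p \<noteq> []" using assms by (auto simp: apath_Nil_iff)
  then obtain q a where "p = q @ [a]" by (metis append_butlast_last_id)
  then show ?thesis using p apath_snoc_parent(1) by blast
qed

text \<open>A path to \<open>v\<close> through \<open>u\<close>, cut at \<open>u\<close>, loses its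
  endpoint \<open>v\<close> and so avoids it; conversely, a path to \<open>u\<close> that avoids
  \<open>v\<close> can be extended by the arc to \<open>v\<close>.\<close>

lemma children_iff_parent: "v \<in> children G r u \<longleftrightarrow> parent u v"
proof
  assume "v \<in> children G r u"
  then obtain p where uv: "u \<rightarrow>\<^bsub>G\<^esub> v" and p: "awalk r p v" "distinct (awalk_verts r p)"
    and u: "u \<in> set (awalk_verts r p)"
    by (auto simp: children_def apath_def)
  from awalk_decomp[OF p(1) u] obtain q s where
    qs: "p = q @ s" "awalk r q u" "awalk u s v" by blast
  have "u \<noteq> v" using uv adj_not_same by blast
  then have "s \<noteq> []" using qs(3) by (auto simp: awalk_Nil_iff)
  \<comment> \<open>As \<open>s\<close> is nonempty, its endpoint \<open>v\<close> lies beyond the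
    cut, so distinctness keeps \<open>v\<close> out of the prefix \<open>q\<close>.\<close>
  then have "v \<in> set (tl (awalk_verts u s))"
    using qs(3) by (cases s) (auto simp: awalk_Cons_iff last_in_awalk_verts)
  moreover have "awalk_verts r p = awalk_verts r q @ tl (awalk_verts u s)"
    using awalk_verts_append[of r q s v] p(1) qs by auto
  ultimately have "apath r q u" "v \<notin> set (awalk_verts r q)"
    using p(2) qs(2) by (auto simp: apath_def)
  then show "parent u v" using uv by (auto simp: parent_iff_apath)
next
  assume "parent u v"
  then obtain p where uv: "u \<rightarrow>\<^bsub>G\<^esub> v" and p: "apath r p u" "v \<notin> set (awalk_verts r p)"
    by (auto simp: parent_iff_apath)
  from apath_snocE[OF p(1) uv p(2)] obtain q where
    q: "apath r q v" "set (awalk_verts r q) = insert v (set (awalk_verts r p))" .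
  have "u \<in> set (awalk_verts r q)"
    using q(2) p(1) by (auto simp: apath_def last_in_awalk_verts)
  then show "v \<in> children G r u"
    using uv q(1) adj_in_verts(2)[OF uv] by (auto simp: children_def)
qed

text \<open>A path from the root to \<open>v\<close> that avoids \<open>u\<close> would still have
  to end with an arc from the only parent of \<open>v\<close>, which is \<open>u\<close>.\<close>

lemma parent_asym:
  assumes "parent u v"
  shows "\<not> parent v u"
proof
  assume "parent v u"
  then obtain p where p: "apath r p v" "u \<notin> set (awalk_verts r p)"
    by (auto simp: parent_iff_apath)
  have "v \<noteq> r" using assms not_parent_root by blast
  then have "p \<noteq> []" using p by (auto simp: apath_Nil_iff)
  then obtain q a where qa: "p = q @ [a]" by (metis append_butlast_last_id)
  then have "u = tail G a" "tail G a \<in> set (awalk_verts r q)"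
    using p(1) assms apath_snoc_parent parent_unique by blast+
  then show False
    using p qa by (auto simp: apath_def awalk_verts_snoc simp del: awalk_append_iff)
qed

text \<open>Take any path from the root to \<open>u\<close>: if it meets \<open>v\<close>, then
  \<open>u\<close> is a child of \<open>v\<close>; otherwise \<open>u\<close> is the parent of
  \<open>v\<close>.\<close>

lemma adj_parent_cases:
  assumes "u \<rightarrow>\<^bsub>G\<^esub> v"
  obtains "parent u v" | "parent v u"
proof -
  obtain p where p: "apath r p u" using apath_from_root[OF adj_in_verts(1)[OF assms]] .
  show thesis
  proof (cases "v \<in> set (awalk_verts r p)")
    case True
    then have "u \<in> children G r v"
      using p adj_sym[OF assms] adj_in_verts(1)[OF assms] by (auto simp: children_def)
    then show thesis using that(2) by (simp add: children_iff_parent)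
  next
    case False
    then show thesis using that(1) p assms by (auto simp: parent_iff_apath)
  qed
qed

text \<open>Collecting the vertices of all paths from the root avoids a proof that the path is
  unique. The size of this set, which for a vertex of \<open>G\<close> includes that vertex itself,
  measures depth in the inductions below.\<close>

definition ancestors :: "'a \<Rightarrow> 'a set" where
  "ancestors v = {w. \<exists>p. apath r p v \<and> w \<in> set (awalk_verts r p)}"

lemma ancestors_subset_verts: "ancestors v \<subseteq> verts G"
  unfolding ancestors_def apath_def awalk_conv by blast

text \<open>No path to \<open>u\<close> meets its child \<open>v\<close>, so each one extends to a
  path to \<open>v\<close>, and \<open>v\<close> itself is new.\<close>

lemma ancestors_psubset:
  assumes "parent u v"
  shows "ancestors u \<subset> ancestors v"
proof -
  have uv: "u \<rightarrow>\<^bsub>G\<^esub> v" using assms by (simp add: parent_def)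
  have off: "v \<notin> ancestors u"
  proof
    assume "v \<in> ancestors u"
    then have "u \<in> children G r v"
      using adj_sym[OF uv] adj_in_verts(1)[OF uv] unfolding children_def ancestors_def by blast
    then show False using assms parent_asym by (simp add: children_iff_parent)
  qed
  have ext: "set (awalk_verts r p) \<union> {v} \<subseteq> ancestors v" if "apath r p u" for p
  proof -
    have "v \<notin> set (awalk_verts r p)" using off that unfolding ancestors_def by blast
    from apath_snocE[OF that uv this] obtain q
      where "apath r q v" "set (awalk_verts r q) = insert v (set (awalk_verts r p))" .
    then show ?thesis unfolding ancestors_def by blast
  qed
  obtain p where "apath r p u" using assms by (auto simp: parent_iff_apath)
  then have "v \<in> ancestors v" using ext by blast
  moreover have "ancestors u \<subseteq> ancestors v" using ext unfolding ancestors_def by blast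
  ultimately show ?thesis using off by blast
qed

section \<open>Closed neighborhoods in terms of parents and children\<close>

lemma adj_iff_parent: "u \<rightarrow>\<^bsub>G\<^esub> v \<longleftrightarrow> parent u v \<or> parent v u"
  using adj_parent_cases adj_sym parent_def by blast

lemma closed_nbhd_eq: "closed_nbhd G v = insert v ({u. parent u v} \<union> children G r v)"
proof -
  have "{u \<in> verts G. u \<rightarrow>\<^bsub>G\<^esub> v} = {u. u \<rightarrow>\<^bsub>G\<^esub> v}" using adj_in_verts(1) by blast
  also have "\<dots> = {u. parent u v} \<union> children G r v"
    by (auto simp: adj_iff_parent children_iff_parent)
  finally show ?thesis by (simp add: closed_nbhd_def)
qed

lemma finite_children: "finite (children G r v)"
  by (rule finite_subset[of _ "verts G"]) (auto simp: children_def)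

text \<open>Keeping the parents as a set lets one formula serve both the root, where it is empty,
  and the other vertices, where it is a singleton.\<close>

lemma sum_closed_nbhd:
  fixes f :: "'a \<Rightarrow> int"
  shows "sum f (closed_nbhd G v) = f v + sum f {u. parent u v} + sum f (children G r v)"
proof -
  have fin: "finite {u. parent u v}"
    by (rule finite_subset[of _ "verts G"]) (auto simp: parent_def dest: adj_in_verts)
  have "v \<notin> {u. parent u v} \<union> children G r v"
    by (auto simp: children_iff_parent parent_def dest: adj_not_same)
  moreover have "{u. parent u v} \<inter> children G r v = {}"
    using parent_asym by (auto simp: children_iff_parent)
  ultimately show ?thesis
    using fin finite_children by (simp add: closed_nbhd_eq sum.union_disjoint)
qed

end

section \<open>Parity of balanced domination functions\<close>

locale rooted_even_tree = rooted_undirected_tree +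
  assumes even_card_children: "v \<in> verts G \<Longrightarrow> even (card (children G r v))"
begin

text \<open>Modulo 2 each child contributes \<open>f v\<close>, and the number of children is
  even.\<close>

lemma even_sum_children:
  fixes f :: "'a \<Rightarrow> int"
  assumes "v \<in> verts G" "\<And>w. parent v w \<Longrightarrow> even (f w - f v)"
  shows "even (sum f (children G r v))"
proof -
  have "even (\<Sum>w\<in>children G r v. f w - f v)"
    using assms(2) by (intro dvd_sum) (auto simp: children_iff_parent)
  moreover have "sum f (children G r v)
      = (\<Sum>w\<in>children G r v. f w - f v) + int (card (children G r v)) * f v"
    by (simp add: sum_subtractf)
  ultimately show ?thesis using even_card_children[OF assms(1)] by simp
qed

lemma bdf_parent_parity:
  assumes "bdf G f" "parent u v"
  shows "even (f v - f u)"
  using assms(2)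
\<comment> \<open>The measure drops from \<open>v\<close> to its children, so the induction climbs
  from the leaves. Leaves need no separate base case, since their sum over children is
  empty.\<close>
proof (induction "card (verts G - ancestors v)" arbitrary: u v rule: less_induct)
  case less
  have v: "v \<in> verts G" using less.prems by (auto simp: parent_def dest: adj_in_verts)
  have "{u. parent u v} = {u}" using less.prems parent_unique by blast
  then have "f v + f u + sum f (children G r v) = 0"
    using assms(1) v sum_closed_nbhd[of f v] by (simp add: bdf_def)
  moreover have "even (sum f (children G r v))"
  proof (rule even_sum_children[OF v])
    fix w assume w: "parent v w"
    then have "verts G - ancestors w \<subset> verts G - ancestors v"
      using ancestors_psubset[OF w] ancestors_subset_verts[of w] by blast
    then show "even (f w - f v)" using less.hyps w by (simp add: psubset_card_mono)
  qed
  ultimately show ?case by presburger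
qed

lemma bdf_root_even:
  assumes "bdf G f"
  shows "even (f r)"
proof -
  have "{u. parent u r} = {}" using not_parent_root by blast
  then have "f r + sum f (children G r r) = 0"
    using assms root_in_verts sum_closed_nbhd[of f r] by (simp add: bdf_def)
  moreover have "even (sum f (children G r r))"
    using root_in_verts bdf_parent_parity[OF assms] by (rule even_sum_children)
  ultimately show ?thesis by presburger
qed

lemma bdf_eq_zero:
  assumes "bdf G f" "v \<in> verts G"
  shows "f v = 0"
proof -
  have "even (f v)"
    using assms(2)
  \<comment> \<open>This induction runs the other way, carrying evenness from the root down to
    \<open>v\<close>.\<close>
  proof (induction "card (ancestors v)" arbitrary: v rule: less_induct)
    case less
    show ?case
    proof (cases "v = r")
      case True
      then show ?thesis using bdf_root_even[OF assms(1)] by simp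
    next
      case False
      then obtain u where u: "parent u v" using parent_exists less.prems by blast
      have "finite (ancestors v)" using ancestors_subset_verts by (rule finite_subset) simp
      then have "even (f u)"
        using less.hyps[of u] u ancestors_psubset[OF u]
        by (auto simp: parent_def psubset_card_mono dest: adj_in_verts)
      then show ?thesis using bdf_parent_parity[OF assms(1) u] by simp
    qed
  qed
  then show ?thesis using assms by (auto simp: bdf_def)
qed

lemma d_balanced_tree: "d_balanced G"
proof -
  have "bdf G (\<lambda>_. 0)" by (simp add: bdf_def)
  \<comment> \<open>BDFs may differ outside the vertex set, so it is the set of weights that is
    shown to be a singleton.\<close>
  then have "{weight G f | f. bdf G f} = {0}"
    using bdf_eq_zero by (force simp: weight_def)
  then show ?thesis by (simp add: d_balanced_def balanced_dom_number_def)
qed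

end

theorem theorem5:
  fixes T :: "('a, 'b) pre_digraph" and r :: 'a
  assumes "full_binary_tree T r"
  shows "(\<forall>f. bdf T f \<longrightarrow> f r = 0) \<and> d_balanced T"
proof -
  have tree: "undirected_tree T" "r \<in> verts T"
    and deg: "\<And>v. v \<in> verts T \<Longrightarrow> card (children T r v) \<in> {0, 2}"
    using assms by (auto simp: full_binary_tree_def binary_tree_def rooted_tree_def)
  interpret graph T using tree by (simp add: undirected_tree_def)
  \<comment> \<open>The child counts 0 and 2 enter the argument through their parity.\<close>
  interpret rooted_even_tree T r
  proof unfold_locales
    show "length p < 3" if "cycle p" for p
      using tree(1) that by (force simp: undirected_tree_def)
    show "even (card (children T r v))" if "v \<in> verts T" for v
      using deg[OF that] by auto
  qed (use tree in \<open>auto simp: undirected_tree_def\<close>)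
  show ?thesis using bdf_eq_zero root_in_verts d_balanced_tree by blast
qed

end
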